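(* Let $\Delta\ge0$ be an integer, let $0<\epsilon\le\frac12$, and let $n\ge\frac{5\Delta}{\epsilon^2}$ be an integer. If $T$ is a reflexive tree of maximum degree at most $\Delta$ and $\sigma$ is a voltage assignment on $T$ into $\mathbb{Z}_n$ that assigns to each loop a group element coprime to $n$, then $T^\sigma$ contains a cycle with at least $(1-\epsilon)|V(T^\sigma)|$ vertices.
   Context: A reflexive tree is a tree with exactly one loop at each vertex; its degree refers to the number of non-loop edges at a vertex. A voltage assignment is a map $\sigma$ from the arcs of $T$ (each edge $[u,v]$ gives arcs $(u,v),(v,u)$; each loop gives two arcs) to $\mathbb{Z}_n$ with $\sigma(v,u)=-\sigma(u,v)$ and the two loop arcs receiving opposite values. The lift $T^\sigma$ has vertex set $V(T)\times\mathbb{Z}_n$, with $(u,a)\sim(v,b)$ iff some arc $(u,v)$ has $\sigma(u,v)=b-a$. *)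

theory Defs
  imports Complex_Main "Graph_Theory.Graph_Theory"
begin

text \<open>
  An undirected graph, possibly with loops and parallel edges, is a \<^locale>\<open>bidirected_digraph\<close>:
  every edge is a pair of mutually inverse, distinct arcs \<open>e\<close> and \<open>arev e\<close>. In particular a loop
  consists of two arcs.

  The cycles of the digraph include the closed walks that traverse one edge back and forth. These
  are not cycles of the undirected graph, and they are the only ones: a cycle with at least three
  vertices never contains an arc together with its inverse. Thus a cycle on two vertices needs two
  parallel edges, and a cycle on one vertex is a loop.
\<close>

definition undirected_cycle :: "('v, 'e) pre_digraph \<Rightarrow> ('e \<Rightarrow> 'e) \<Rightarrow> 'e list \<Rightarrow> bool" where
  "undirected_cycle G arev p \<longleftrightarrow> pre_digraph.cycle G p \<and> (\<forall>e\<in>set p. arev e \<notin> set p)"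

definition cycle_verts :: "('v, 'e) pre_digraph \<Rightarrow> 'e list \<Rightarrow> 'v set" where
  "cycle_verts G p = tail G ` set p"

text \<open>
  The predicate \<^const>\<open>tree\<close> of the library is about digraph cycles, so no symmetric digraph with
  an arc satisfies it.
\<close>

definition undirected_tree :: "('v, 'e) pre_digraph \<Rightarrow> ('e \<Rightarrow> 'e) \<Rightarrow> bool" where
  "undirected_tree G arev \<longleftrightarrow> Digraph_Component.connected G \<and> \<not> (\<exists>p. undirected_cycle G arev p)"

definition loops_at :: "('v, 'e) pre_digraph \<Rightarrow> 'v \<Rightarrow> 'e set" where
  "loops_at G v = {e \<in> arcs G. tail G e = v \<and> head G e = v}"

definition delete_loops :: "('v, 'e) pre_digraph \<Rightarrow> ('v, 'e) pre_digraph" where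
  "delete_loops G = G\<lparr>arcs := {e \<in> arcs G. tail G e \<noteq> head G e}\<rparr>"

definition reflexive_tree :: "('v, 'e) pre_digraph \<Rightarrow> ('e \<Rightarrow> 'e) \<Rightarrow> bool" where
  "reflexive_tree T arev \<longleftrightarrow>
     fin_digraph T \<and> bidirected_digraph T arev \<and>
     undirected_tree (delete_loops T) arev \<and>
     (\<forall>v\<in>verts T. card (loops_at T v) = 2)" \<comment> \<open>the two arcs of a single loop\<close>

definition nonloop_degree :: "('v, 'e) pre_digraph \<Rightarrow> 'v \<Rightarrow> nat" where
  "nonloop_degree G v = out_degree (delete_loops G) v"

text \<open>The group \<open>\<int>\<^sub>n\<close> is represented by the residues \<open>{0..<n}\<close> with arithmetic modulo \<open>n\<close>.\<close>

definition voltage_assignment ::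
    "nat \<Rightarrow> ('v, 'e) pre_digraph \<Rightarrow> ('e \<Rightarrow> 'e) \<Rightarrow> ('e \<Rightarrow> int) \<Rightarrow> bool" where
  "voltage_assignment n T arev \<sigma> \<longleftrightarrow>
     (\<forall>e\<in>arcs T. \<sigma> e \<in> {0..<int n} \<and> \<sigma> (arev e) = (- \<sigma> e) mod int n)"

text \<open>
  Every arc \<open>e\<close> from \<open>u\<close> to \<open>v\<close> and every \<open>a\<close> in \<open>\<int>\<^sub>n\<close> give an arc of the lift from \<open>(u, a)\<close> to
  \<open>(v, a + \<sigma> e)\<close>, whose inverse is the arc given by \<open>arev e\<close> and \<open>a + \<sigma> e\<close>.
\<close>

definition lift ::
    "nat \<Rightarrow> ('v, 'e) pre_digraph \<Rightarrow> ('e \<Rightarrow> int) \<Rightarrow> ('v \<times> int, 'e \<times> int) pre_digraph" where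
  "lift n T \<sigma> =
     \<lparr>verts = verts T \<times> {0..<int n},
      arcs = arcs T \<times> {0..<int n},
      tail = (\<lambda>(e, a). (tail T e, a)),
      head = (\<lambda>(e, a). (head T e, (a + \<sigma> e) mod int n))\<rparr>"

definition lift_rev ::
    "nat \<Rightarrow> ('v, 'e) pre_digraph \<Rightarrow> ('e \<Rightarrow> 'e) \<Rightarrow> ('e \<Rightarrow> int) \<Rightarrow> 'e \<times> int \<Rightarrow> 'e \<times> int" where
  "lift_rev n T arev \<sigma> = (\<lambda>(e, a).
     if (e, a) \<in> arcs (lift n T \<sigma>) then (arev e, (a + \<sigma> e) mod int n) else (e, a))"

lemma bidirected_digraph_lift:
  assumes "bidirected_digraph T arev" and "voltage_assignment n T arev \<sigma>"
  shows "bidirected_digraph (lift n T \<sigma>) (lift_rev n T arev \<sigma>)"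
proof -
  interpret bidirected_digraph T arev by fact
  have shift_back: "((a + \<sigma> e) mod int n + \<sigma> (arev e)) mod int n = a"
    if "e \<in> arcs T" "0 \<le> a" "a < int n" for e a
  proof -
    have "\<sigma> (arev e) = (- \<sigma> e) mod int n"
      using assms(2) that by (auto simp: voltage_assignment_def)
    then show ?thesis
      using that by (simp add: mod_simps)
  qed
  show ?thesis
  proof (unfold_locales, goal_cases)
    case (3 x)
    then show ?case
      by (cases x) (auto simp: lift_def lift_rev_def arev_neq)
  next
    case (4 x)
    then show ?case
      by (cases x) (simp add: lift_def lift_rev_def shift_back)
  qed (auto simp: lift_def lift_rev_def)
qed

lemma lift_adjacent_iff:
  assumes "voltage_assignment n T arev \<sigma>"
    and "u \<in> verts T" "v \<in> verts T" "a \<in> {0..<int n}" "b \<in> {0..<int n}"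
  shows "(u, a) \<rightarrow>\<^bsub>lift n T \<sigma>\<^esub> (v, b) \<longleftrightarrow>
    (\<exists>e\<in>arcs T. tail T e = u \<and> head T e = v \<and> \<sigma> e = (b - a) mod int n)"
proof -
  have "(a + \<sigma> e) mod int n = b \<longleftrightarrow> \<sigma> e = (b - a) mod int n" if "e \<in> arcs T" for e
  proof -
    have "\<sigma> e mod int n = \<sigma> e" "b mod int n = b"
      using assms that by (auto simp: voltage_assignment_def)
    then show ?thesis
      by (metis add.commute add_diff_cancel_right' diff_add_cancel mod_add_left_eq mod_diff_left_eq)
  qed
  then show ?thesis
    using assms(4) by (force simp: arcs_ends_conv lift_def image_iff)
qed


end

theory Submission
  imports Defs "HOL-Analysis.Kronecker_Approximation_Theorem" "HOL-Library.Sublist" "HOL-Number_Theory.Cong"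
begin

text \<open>
  The fibre over a vertex \<open>v\<close> is a Hamiltonian cycle of its own, traversed by the lifts of a loop at
  \<open>v\<close>. Vertices are added one at a time along a non-loop arc \<open>f\<close> from \<open>v\<close> to \<open>w\<close>. Dirichlet's
  approximation theorem gives \<open>j \<le> J\<close> and \<open>i \<le> n div J\<close> such that \<open>j\<close> loop steps in the fibre of \<open>v\<close>
  cancel \<open>i\<close> loop steps in the fibre of \<open>w\<close>. So \<open>j\<close> consecutive arcs of the cycle over \<open>v\<close> can be
  replaced by a lift of \<open>f\<close>, a run of \<open>n - i\<close> loop arcs over \<open>w\<close>, and a lift of the inverse of \<open>f\<close>.
  At most \<open>n div J + J\<close> vertices are lost per fibre, and there is room for these detours as long as
  \<open>n div J + J * \<Delta> \<le> n\<close>. The choice \<open>J = \<lceil>sqrt (n / \<Delta>)\<rceil>\<close> makes the left-hand side at most \<open>\<epsilon> * n\<close>.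
\<close>

section \<open>Preliminaries on sublists and on small multiples modulo \<open>n\<close>\<close>

lemma sublist_append_disjoint:
  assumes "sublist xs (ps @ m @ ss)" and "set xs \<inter> set m = {}" and "m \<noteq> []"
  shows "sublist xs ps \<or> sublist xs ss"
proof -
  \<comment> \<open>A sublist reaching across either end of \<open>m\<close> would contain the first
    or the last element of \<open>m\<close>, against disjointness; so the straddling cases cannot
    occur.\<close>
  have "xs = []" if "suffix xs1 ps" "prefix xs2 (m @ ss)" "xs = xs1 @ xs2" "xs2 \<noteq> []" for xs1 xs2
    using that assms(2,3) by (cases m; cases xs2) auto
  moreover have "xs = []" if "suffix xs1 m" "prefix xs2 ss" "xs = xs1 @ xs2" "xs1 \<noteq> []" for xs1 xs2
    using that assms(2) set_mono_suffix[of xs1 m] by (cases xs1) auto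
  moreover have "xs = []" if "sublist xs m"
    using set_mono_sublist[OF that] assms(2) by (simp add: Int_absorb2)
  ultimately show ?thesis
    using assms(1) unfolding sublist_append
    by (metis append.right_neutral append_Nil prefix_imp_sublist suffix_imp_sublist sublist_Nil_left)
qed

text \<open>Dividing by the unit \<open>y\<close> turns the claim into one about multiples of
  \<open>z\<close>, the quotient of \<open>x\<close> by \<open>y\<close> modulo \<open>n\<close>.
  Approximating \<open>z / n\<close> by a fraction with denominator \<open>k \<le> J\<close> gives a
  residue \<open>d\<close> of \<open>k * z\<close> with \<open>\<bar>d\<bar> < n / J\<close>, and
  \<open>k * x\<close> is congruent to \<open>d * y\<close>. The sign of \<open>d\<close> goes into
  \<open>s\<close>, which makes both multipliers natural numbers.\<close>

lemma small_multiples_cong: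
  fixes x y :: int and n J :: nat
  assumes "coprime y (int n)" and "n > 0" and "J > 0"
  obtains j i :: nat and s where "0 < j" "j \<le> J" "i \<le> n div J" "s = y \<or> s = - y"
    "int n dvd int j * x + int i * s"
proof -
  obtain y' where y': "[y * y' = 1] (mod int n)"
    using assms(1) cong_solve_coprime_int by blast
  define z where "z = x * y'"
  obtain h k where k: "0 < k" "k \<le> int J"
    and hk: "\<bar>of_int k * (of_int z / real n) - of_int h\<bar> < 1 / J"
    using Dirichlet_approx[OF assms(3)] by metis
  define d where "d = k * z - h * int n"
  have "\<bar>real_of_int d\<bar> = \<bar>of_int k * (of_int z / real n) - of_int h\<bar> * n"
  proof -
    have "real_of_int d = (of_int k * (of_int z / real n) - of_int h) * n"
      using assms(2) by (simp add: d_def field_simps)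
    then show ?thesis by (simp add: abs_mult)
  qed
  also have "\<dots> < n / J"
    using mult_strict_right_mono[OF hk, of "real n"] assms(2) by simp
  finally have "\<bar>real_of_int d\<bar> * J < n"
    using assms(3) by (simp add: field_simps)
  then have "real (nat \<bar>d\<bar> * J) \<le> real n" by simp
  then have "nat \<bar>d\<bar> * J \<le> n" by (simp only: of_nat_le_iff)
  then have i: "nat \<bar>d\<bar> \<le> n div J"
    using assms(3) by (simp add: less_eq_div_iff_mult_less_eq)
  have "[d * y = k * x * (y * y')] (mod int n)"
    unfolding cong_iff_dvd_diff d_def z_def by (simp add: algebra_simps)
  also have "[k * x * (y * y') = k * x * 1] (mod int n)"
    using y' by (rule cong_scalar_left)
  finally have dvd: "int n dvd k * x - d * y"
    by (simp add: cong_iff_dvd_diff dvd_diff_commute)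
  show ?thesis
  proof (cases "d \<ge> 0")
    case True
    show ?thesis
      by (rule that[of "nat k" "nat \<bar>d\<bar>" "-y"]) (use k i dvd True in auto)
  next
    case False
    show ?thesis
      by (rule that[of "nat k" "nat \<bar>d\<bar>" y]) (use k i dvd False in auto)
  qed
qed

section \<open>The lift and runs of lifted loop arcs\<close>

locale unit_loop_voltages = bidirected_digraph T arev
  for T :: "('v, 'e) pre_digraph" and arev :: "'e \<Rightarrow> 'e" +
  fixes \<sigma> :: "'e \<Rightarrow> int" and n :: nat
  assumes fin: "fin_digraph T"
    and voltage: "voltage_assignment n T arev \<sigma>"
    and loop_ex: "v \<in> verts T \<Longrightarrow> loops_at T v \<noteq> {}"
    and loop_coprime: "v \<in> verts T \<Longrightarrow> e \<in> loops_at T v \<Longrightarrow> coprime (\<sigma> e) (int n)"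
begin

abbreviation "L \<equiv> lift n T \<sigma>"
abbreviation "rev_L \<equiv> lift_rev n T arev \<sigma>"

sublocale L: bidirected_digraph L rev_L
  by (rule bidirected_digraph_lift) (use voltage in \<open>auto intro: bidirected_digraph\<close>)

lemma lift_simps [simp]:
  "verts L = verts T \<times> {0..<int n}"
  "arcs L = arcs T \<times> {0..<int n}"
  "tail L (e, a) = (tail T e, a)"
  "head L (e, a) = (head T e, (a + \<sigma> e) mod int n)"
  by (simp_all add: lift_def)

lemma rev_L_eq: "e \<in> arcs T \<Longrightarrow> a \<in> {0..<int n} \<Longrightarrow> rev_L (e, a) = (arev e, (a + \<sigma> e) mod int n)"
  by (simp add: lift_rev_def)

lemma volt_arev: "e \<in> arcs T \<Longrightarrow> \<sigma> (arev e) = (- \<sigma> e) mod int n"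
  using voltage by (simp add: voltage_assignment_def)

lemma arev_loop: "e \<in> loops_at T v \<Longrightarrow> arev e \<in> loops_at T v"
  by (auto simp: loops_at_def)

definition loop_run :: "'e \<Rightarrow> int \<Rightarrow> nat \<Rightarrow> ('e \<times> int) list" where
  "loop_run e a k = map (\<lambda>t. (e, (a + int t * \<sigma> e) mod int n)) [0..<k]"

lemma length_loop_run [simp]: "length (loop_run e a k) = k"
  by (simp add: loop_run_def)

lemma set_loop_run: "x \<in> set (loop_run e a k) \<Longrightarrow> fst x = e"
  by (auto simp: loop_run_def)

lemma loop_run_add:
  "loop_run e a (k + m) = loop_run e a k @ loop_run e ((a + int k * \<sigma> e) mod int n) m"
proof -
  have "[0..<k + m] = [0..<k] @ map (\<lambda>t. t + k) [0..<m]"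
    using upt_add_eq_append[of 0 k m] map_add_upt[of k m] by (simp only: le0 add.commute)
  moreover have "(a + int (t + k) * \<sigma> e) mod int n
      = ((a + int k * \<sigma> e) mod int n + int t * \<sigma> e) mod int n" for t
    by (simp add: mod_add_left_eq mod_add_right_eq algebra_simps)
  ultimately show ?thesis
    by (simp add: loop_run_def o_def del: of_nat_add)
qed

lemma awalk_loop_run:
  assumes "e \<in> loops_at T v" and "a \<in> {0..<int n}"
  shows "L.awalk (v, a) (loop_run e a k) (v, (a + int k * \<sigma> e) mod int n)"
proof (induction k)
  case 0
  then show ?case
    using assms by (auto simp: loop_run_def L.awalk_Nil_iff loops_at_def)
next
  case (Suc k)
  have "0 < int n" using assms(2) by auto
  have "L.awalk (v, (a + int k * \<sigma> e) mod int n) [(e, (a + int k * \<sigma> e) mod int n)]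
     (v, (a + int (Suc k) * \<sigma> e) mod int n)"
    using assms \<open>0 < int n\<close>
    by (auto simp: L.awalk_simps loops_at_def mod_add_left_eq mod_add_right_eq algebra_simps)
  from L.awalk_appendI[OF Suc this] show ?case
    by (simp only: loop_run_def upt_Suc_append map_append list.map zero_le)
qed

lemma tails_loop_run:
  assumes "e \<in> loops_at T v"
  shows "map (tail L) (loop_run e a k) = map (\<lambda>t. (v, (a + int t * \<sigma> e) mod int n)) [0..<k]"
  using assms by (simp add: loop_run_def loops_at_def)

text \<open>A unit can be cancelled modulo \<open>n\<close>. Hence a run of at most \<open>n\<close>
  loop arcs repeats no vertex, and a run of \<open>n\<close> arcs visits the whole fibre.\<close>

lemma inj_on_loop_multiples:
  assumes "e \<in> loops_at T v"
  shows "inj_on (\<lambda>t. (a + int t * \<sigma> e) mod int n) {..<n}"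
proof (rule inj_onI)
  fix t t' assume t: "t \<in> {..<n}" "t' \<in> {..<n}"
    and eq: "(a + int t * \<sigma> e) mod int n = (a + int t' * \<sigma> e) mod int n"
  have v: "v \<in> verts T" using assms by (auto simp: loops_at_def)
  have "[a + int t * \<sigma> e = a + int t' * \<sigma> e] (mod int n)"
    using eq by (simp only: cong_def)
  then have "[int t = int t'] (mod int n)"
    using loop_coprime[OF v assms] by (simp only: cong_add_lcancel cong_mult_rcancel)
  then show "t = t'"
    using t by (simp add: cong_def)
qed

lemma distinct_tails_loop_run:
  assumes "e \<in> loops_at T v" and "k \<le> n"
  shows "distinct (map (tail L) (loop_run e a k))"
proof -
  have "inj_on (\<lambda>t. (v, (a + int t * \<sigma> e) mod int n)) {0..<k}"
    using inj_on_loop_multiples[OF assms(1), of a] assms(2)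
    by (intro inj_onI) (simp add: inj_on_def)
  then show ?thesis
    unfolding tails_loop_run[OF assms(1)] by (simp add: distinct_map)
qed

section \<open>Partial cycles and their extension by a detour into a new fibre\<close>

definition nbr_arcs :: "'v \<Rightarrow> 'v set \<Rightarrow> 'e set" where
  "nbr_arcs v S = {f \<in> arcs T. tail T f = v \<and> head T f \<in> S - {v}}"

text \<open>
  The last clause keeps in every fibre a run of loop arcs that is still long enough for the detours
  to the neighbours outside \<open>S\<close>. The arc to the vertex from which \<open>v\<close> was attached is counted as well,
  although its detour is already paid for by \<open>I\<close>.
\<close>

definition partial_cycle :: "nat \<Rightarrow> nat \<Rightarrow> 'v set \<Rightarrow> 'v \<times> int \<Rightarrow> ('e \<times> int) list \<Rightarrow> bool" where
  "partial_cycle I J S u p \<longleftrightarrow>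
     S \<subseteq> verts T \<and> L.awalk u p u \<and> p \<noteq> [] \<and> distinct (map (tail L) p) \<and>
     (\<forall>x\<in>set p. tail T (fst x) \<in> S \<and> head T (fst x) \<in> S \<and> rev_L x \<notin> set p) \<and>
     card S * n \<le> length p + card S * (I + J) \<and>
     (\<forall>v\<in>S. \<exists>e\<in>loops_at T v. \<exists>a\<in>{0..<int n}. \<exists>r.
        sublist (loop_run e a r) p \<and> n \<le> r + I + J * card (nbr_arcs v S))"

text \<open>The arcs of a run all lie over \<open>e\<close> and their inverses over the distinct arc
  \<open>arev e\<close>. So a run never traverses an edge back and forth, even if \<open>n\<close>
  is 1 or 2.\<close>

lemma rev_L_loop_run:
  assumes "e \<in> loops_at T v" "x \<in> set (loop_run e a k)" "n > 0"
  shows "fst (rev_L x) = arev e" "arev e \<noteq> e"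
  using assms by (auto simp: loop_run_def loops_at_def rev_L_eq arev_neq)

lemma finite_nbr_arcs: "finite (nbr_arcs v S)"
  using fin_digraph.finite_arcs[OF fin] by (simp add: nbr_arcs_def)

lemma partial_cycle_base:
  assumes "v \<in> verts T" "n > 0"
  shows "\<exists>u p. partial_cycle I J {v} u p"
proof -
  obtain e where e: "e \<in> loops_at T v" using loop_ex assms by blast
  let ?p = "loop_run e 0 n"
  have te: "tail T e = v" "head T e = v" using e by (auto simp: loops_at_def)
  have aw: "L.awalk (v, 0) ?p (v, 0)"
    using awalk_loop_run[OF e, of 0 n] assms(2) by simp
  have p: "?p \<noteq> []" using assms(2) by (simp add: loop_run_def)
  have "partial_cycle I J {v} (v, 0) ?p"
    unfolding partial_cycle_def
  proof (intro conjI ballI)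
    fix x assume x: "x \<in> set ?p"
    show "tail T (fst x) \<in> {v}" "head T (fst x) \<in> {v}"
      using set_loop_run[OF x] te by simp_all
    show "rev_L x \<notin> set ?p"
      using set_loop_run[of "rev_L x" e 0 n] rev_L_loop_run[OF e x assms(2)] by metis
  next
    fix x assume "x \<in> {v}"
    then show "\<exists>e\<in>loops_at T x. \<exists>a\<in>{0..<int n}. \<exists>r.
        sublist (loop_run e a r) ?p \<and> n \<le> r + I + J * card (nbr_arcs x {v})"
      using e assms(2) by (intro bexI[of _ e] bexI[of _ 0] exI[of _ n]) auto
  qed (use assms(1) aw p distinct_tails_loop_run[OF e] in simp_all)
  then show ?thesis by blast
qed

text \<open>Either sign in \<open>small_multiples_cong\<close> is the voltage of one of the two arcs
  \<open>f\<close> and \<open>arev f\<close> of the loop at \<open>w\<close>. If \<open>i\<close>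
  were 0, then \<open>n\<close> would divide \<open>j\<close>, although
  \<open>0 < j \<le> J < n\<close>. Positivity of \<open>i\<close> later keeps the endpoints of the
  new run distinct from each other.\<close>

lemma short_detour:
  assumes e: "e \<in> loops_at T v" and w: "w \<in> verts T" and J: "0 < J" "J < n"
  obtains j i e' where "0 < j" "j \<le> J" "0 < i" "i \<le> n div J" "e' \<in> loops_at T w"
    "int n dvd int j * \<sigma> e + int i * \<sigma> e'"
proof -
  have v: "v \<in> verts T" using e by (auto simp: loops_at_def)
  obtain f where f: "f \<in> loops_at T w" using loop_ex w by blast
  have n: "n > 0" using J by simp
  obtain j i s where ji: "0 < j" "j \<le> J" "i \<le> n div J" "s = \<sigma> f \<or> s = - \<sigma> f"
    and dvd: "int n dvd int j * \<sigma> e + int i * s"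
    by (rule small_multiples_cong[OF loop_coprime[OF w f] n J(1), where x = "\<sigma> e"])
  obtain e' where e': "e' \<in> loops_at T w" "[\<sigma> e' = s] (mod int n)"
    using ji(4)
  proof
    assume "s = \<sigma> f" then show ?thesis using f by (intro that[of f]) auto
  next
    assume "s = - \<sigma> f" then show ?thesis using f volt_arev[of f]
      by (intro that[of "arev f"] arev_loop) (auto simp: loops_at_def)
  qed
  have "[int j * \<sigma> e + int i * \<sigma> e' = int j * \<sigma> e + int i * s] (mod int n)"
    using e'(2) by (intro cong_add cong_mult) auto
  then have dvd': "int n dvd int j * \<sigma> e + int i * \<sigma> e'"
    using dvd cong_dvd_iff by (metis cong_0_iff cong_trans)
  have "i > 0"
  proof (rule ccontr)
    assume "\<not> i > 0"
    then have "int n dvd int j"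
      using dvd' loop_coprime[OF v e] by (simp add: coprime_commute coprime_dvd_mult_left_iff)
    then show False using ji J by (auto dest: dvd_imp_le)
  qed
  then show ?thesis using that ji e' dvd' by blast
qed

text \<open>The detour removes at most \<open>J\<close> arcs over \<open>v\<close> and omits at most
  \<open>I\<close> of the \<open>n\<close> loop arcs over \<open>w\<close>, which one more summand
  \<open>I + J\<close> pays for. The hypothesis \<open>room\<close> ensures that the run kept over
  \<open>v\<close> still has \<open>J\<close> arcs to cut from.\<close>

lemma partial_cycle_step:
  assumes pc: "partial_cycle I J S u p"
    and f: "f \<in> arcs T" "tail T f = v" "head T f = w" and v: "v \<in> S" and wS: "w \<notin> S"
    and J: "0 < J" "J < n" and I: "n div J \<le> I"
    and room: "I + J * card (nbr_arcs v (insert w S)) \<le> n"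
  shows "\<exists>u p. partial_cycle I J (insert w S) u p"
proof -
  let ?S = "insert w S"
  have w: "w \<in> verts T" using f by auto
  have vw: "v \<noteq> w" using v wS by blast
  have SV: "S \<subseteq> verts T" and aw: "L.awalk u p u" and dist: "distinct (map (tail L) p)"
    and inS: "\<And>x. x \<in> set p \<Longrightarrow> tail T (fst x) \<in> S \<and> head T (fst x) \<in> S"
    and norev: "\<And>x. x \<in> set p \<Longrightarrow> rev_L x \<notin> set p"
    and len: "card S * n \<le> length p + card S * (I + J)"
    and reserve: "\<And>x. x \<in> S \<Longrightarrow> \<exists>e\<in>loops_at T x. \<exists>a\<in>{0..<int n}. \<exists>r.
        sublist (loop_run e a r) p \<and> n \<le> r + I + J * card (nbr_arcs x S)"
    using pc unfolding partial_cycle_def by auto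
  have finS: "finite S" using SV fin_digraph.finite_verts[OF fin] finite_subset by blast
  have nbr_mono: "card (nbr_arcs x S) \<le> card (nbr_arcs x ?S)" for x
    by (rule card_mono[OF finite_nbr_arcs]) (auto simp: nbr_arcs_def)
  have nbr_v: "card (nbr_arcs v S) < card (nbr_arcs v ?S)"
  proof (rule psubset_card_mono[OF finite_nbr_arcs])
    have "nbr_arcs v S \<subseteq> nbr_arcs v ?S" by (auto simp: nbr_arcs_def)
    moreover have "f \<in> nbr_arcs v ?S" using f vw by (simp add: nbr_arcs_def)
    moreover have "f \<notin> nbr_arcs v S" using f wS by (simp add: nbr_arcs_def)
    ultimately show "nbr_arcs v S \<subset> nbr_arcs v ?S" by blast
  qed
  obtain e a r where e: "e \<in> loops_at T v" and a: "a \<in> {0..<int n}"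
    and sub: "sublist (loop_run e a r) p" and r: "n \<le> r + I + J * card (nbr_arcs v S)"
    using reserve[OF v] by blast
  have te: "tail T e = v" "head T e = v" "e \<in> arcs T" using e by (auto simp: loops_at_def)
  obtain j i e' where ji: "0 < j" "j \<le> J" "0 < i" "i \<le> n div J" and e': "e' \<in> loops_at T w"
    and dvd: "int n dvd int j * \<sigma> e + int i * \<sigma> e'"
    using short_detour[OF e w J] by blast
  have te': "tail T e' = w" "head T e' = w" "e' \<in> arcs T" using e' by (auto simp: loops_at_def)
  \<comment> \<open>Counting \<open>w\<close> as a neighbour raises the allowance at
    \<open>v\<close> by at least \<open>J\<close>. Compared with \<open>room\<close> this gives
    \<open>J \<le> r\<close>, and it absorbs the \<open>j\<close> arcs about to be cut.\<close>
  have "J * Suc (card (nbr_arcs v S)) \<le> J * card (nbr_arcs v ?S)"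
    using nbr_v by (intro mult_le_mono) auto
  then have Jr: "J \<le> r" and r_new: "n \<le> (r - j) + I + J * card (nbr_arcs v ?S)"
    using r room ji by auto
  have iI: "i \<le> I" using ji I by simp
  have "card (nbr_arcs v ?S) > 0" using nbr_v by simp
  then have "J \<le> J * card (nbr_arcs v ?S)" by simp
  then have "I + J \<le> n" using room by linarith
  then have i_n: "i < n" using iI J by linarith
  define a2 where "a2 = (a + int j * \<sigma> e) mod int n"
  have a2: "a2 \<in> {0..<int n}" using J by (simp add: a2_def)
  obtain ps ss where p: "p = ps @ loop_run e a r @ ss" using sub by (auto simp: sublist_def)
  \<comment> \<open>The cut takes the first \<open>j\<close> arcs of the reserved run; the other
    \<open>r - j\<close> remain together as the new reserve over \<open>v\<close>.\<close>
  define rest where "rest = loop_run e a2 (r - j) @ ss"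
  have p': "p = ps @ loop_run e a j @ rest"
    using p loop_run_add[of e a j "r - j"] ji Jr by (simp add: rest_def a2_def)
  have run_Cons: "loop_run e a j = (e, a) # tl (loop_run e a j)"
    using ji(1) a by (cases j) (auto simp: loop_run_def upt_conv_Cons simp del: upt_Suc)
  have awl: "L.awalk u ps (v, a)" and aw2: "L.awalk (v, a) (loop_run e a j @ rest) u"
  proof -
    have 1: "L.awalk u ps (L.awlast u ps)" "L.awalk (L.awlast u ps) (loop_run e a j @ rest) u"
      using aw unfolding p' by auto
    moreover have "L.awlast u ps = (v, a)"
      using 1(2) te by (subst (asm) run_Cons) (simp add: L.awalk_simps)
    ultimately show "L.awalk u ps (v, a)" "L.awalk (v, a) (loop_run e a j @ rest) u" by auto
  qed
  have awr: "L.awalk (v, a2) rest u"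
    using aw2 awalk_loop_run[OF e a, of j] by (auto simp: a2_def)
  define b where "b = (a + \<sigma> f) mod int n"
  have b: "b \<in> {0..<int n}" using J by (simp add: b_def)
  define b2 where "b2 = (b + int (n - i) * \<sigma> e') mod int n"
  have b2: "b2 \<in> {0..<int n}" using J by (simp add: b2_def)
  define W where "W = loop_run e' b (n - i)"
  define p2 where "p2 = ps @ (f, a) # W @ (arev f, b2) # rest"
  \<comment> \<open>The return arc must land where the removed segment ended. The voltages of
    \<open>f\<close> and \<open>arev f\<close> cancel, and \<open>(n - i) * \<sigma> e'\<close> is
    congruent to \<open>- i * \<sigma> e'\<close>, hence to \<open>j * \<sigma> e\<close>.\<close>
  have a2_back: "(b2 + \<sigma> (arev f)) mod int n = a2"
  proof -
    have "(b2 + \<sigma> (arev f)) mod int n = (a + int (n - i) * \<sigma> e') mod int n"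
    proof -
      have "(b2 + \<sigma> (arev f)) mod int n = (a + \<sigma> f + int (n - i) * \<sigma> e' + - \<sigma> f) mod int n"
        unfolding b2_def b_def volt_arev[OF f(1)] by (simp only: mod_add_left_eq mod_add_right_eq)
      then show ?thesis by simp
    qed
    also have "\<dots> = (a + int j * \<sigma> e) mod int n"
    proof -
      have "(a + int (n - i) * \<sigma> e') - (a + int j * \<sigma> e)
          = int n * \<sigma> e' - (int j * \<sigma> e + int i * \<sigma> e')"
        using i_n by (simp add: algebra_simps of_nat_diff)
      moreover have "int n dvd int n * \<sigma> e' - (int j * \<sigma> e + int i * \<sigma> e')"
        using dvd by (intro dvd_diff) auto
      ultimately show ?thesis
        by (simp only: mod_eq_dvd_iff)
    qed
    finally show ?thesis by (simp add: a2_def)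
  qed
  have aw_new: "L.awalk u p2 u"
    unfolding p2_def
  proof (rule L.awalk_appendI[OF awl])
    have "L.awalk (w, b2) ((arev f, b2) # rest) u"
      using awr f b2 a2_back by (simp add: L.awalk_simps)
    then have "L.awalk (w, b) (W @ (arev f, b2) # rest) u"
      using L.awalk_appendI[OF awalk_loop_run[OF e' b, of "n - i"]] by (simp add: W_def b2_def)
    then show "L.awalk (v, a) ((f, a) # W @ (arev f, b2) # rest) u"
      using f a by (simp add: L.awalk_Cons_iff b_def[symmetric] del: L.awalk_append_iff)
  qed
  \<comment> \<open>The return arc starts where \<open>W\<close> ends, so its tail continues the run
    by one vertex. The resulting \<open>n - i + 1\<close> tails are distinct because
    \<open>i > 0\<close>.\<close>
  have W_tails: "map (tail L) (W @ [(arev f, b2)]) = map (tail L) (loop_run e' b (Suc (n - i)))"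
    using f te' by (simp add: W_def b2_def loop_run_def)
  have old_tail: "fst (tail L x) \<in> S" if "x \<in> set p" for x
    using inS[OF that] by (cases x) auto
  have dist_new: "distinct (map (tail L) p2)"
  proof -
    \<comment> \<open>The arc \<open>(f, a)\<close> has the tail of the first removed arc
      \<open>(e, a)\<close>. Thus the tails outside the new fibre are those of \<open>p\<close> with
      the inner vertices of the removed segment dropped.\<close>
    let ?old = "map (tail L) ps @ (v, a) # map (tail L) rest"
    let ?new = "map (tail L) (W @ [(arev f, b2)])"
    have new_dist: "distinct ?new"
      unfolding W_tails using distinct_tails_loop_run[OF e'] ji(3) i_n by simp
    have new_fst: "fst ` set ?new \<subseteq> {w}"
      unfolding W_tails tails_loop_run[OF e'] by auto
    have "tail L (e, a) = (v, a)" using te by simp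
    then have old_dist: "distinct ?old"
      using dist unfolding p' by (subst (asm) run_Cons) auto
    have "\<forall>x\<in>set p. fst (tail L x) \<in> S" using old_tail by blast
    then have old_fst: "fst ` set ?old \<subseteq> S"
      using v unfolding p' by (simp add: image_subset_iff ball_Un)
    have disj: "set ?new \<inter> set ?old = {}"
    proof (rule ccontr)
      assume "set ?new \<inter> set ?old \<noteq> {}"
      then obtain y where "y \<in> set ?new" "y \<in> set ?old" by blast
      then have "fst y = w" "fst y \<in> S" using new_fst old_fst by blast+
      then show False using wS by simp
    qed
    have p2_tails: "map (tail L) p2 = map (tail L) ps @ (v, a) # ?new @ map (tail L) rest"
      using f by (simp add: p2_def)
    have ins: "distinct (A @ x # C @ B)"
      if "distinct (A @ x # B)" "distinct C" "set C \<inter> set (A @ x # B) = {}"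
      for A B C :: "('v \<times> int) list" and x
      using that by auto
    show ?thesis
      unfolding p2_tails using old_dist new_dist disj by (rule ins)
  qed
  have set_p2: "set p2 \<subseteq> set p \<union> {(f, a), (arev f, b2)} \<union> set W"
    unfolding p2_def p' by auto
  \<comment> \<open>This separates the two lifts of the edge of \<open>f\<close>: were
    \<open>a = a2\<close>, the return arc would be the inverse of the outgoing one.\<close>
  have "a \<noteq> a2"
  proof
    assume "a = a2"
    then have "int n dvd int j * \<sigma> e"
      using a unfolding a2_def by (metis add_diff_cancel_left' atLeastLessThan_iff mod_eq_dvd_iff mod_pos_pos_trivial)
    then have "int n dvd int j"
      using loop_coprime[OF _ e] v SV by (auto simp: coprime_commute coprime_dvd_mult_left_iff)
    then show False using ji J by (auto dest: dvd_imp_le)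
  qed
  have rev_new: "rev_L x \<notin> set p2 \<and> tail T (fst x) \<in> ?S \<and> head T (fst x) \<in> ?S" if x: "x \<in> set p2" for x
  proof -
    have p_arcs: "fst y \<in> arcs T" "snd y \<in> {0..<int n}" if "y \<in> set p" for y
      using aw that by (cases y; force simp: L.awalk_def)+
    have newW: "fst y = e'" if "y \<in> set W" for y using that set_loop_run W_def by blast
    consider (old) "x \<in> set p" | (out) "x = (f, a)" | (ret) "x = (arev f, b2)" | (W) "x \<in> set W"
      using x set_p2 by blast
    then show ?thesis
    proof cases
      case old
      \<comment> \<open>The inverse of an old arc has both ends over \<open>S\<close>, whereas every
        new arc has an end over \<open>w\<close>.\<close>
      have r: "tail T (fst (rev_L x)) \<in> S" "head T (fst (rev_L x)) \<in> S"
        using inS[OF old] p_arcs[OF old] by (cases x; simp add: rev_L_eq)+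
      have "rev_L x \<notin> set W" using newW[of "rev_L x"] r(1) te'(1) wS by auto
      moreover have "rev_L x \<noteq> (f, a)" "rev_L x \<noteq> (arev f, b2)" using r f wS by auto
      ultimately show ?thesis using norev[OF old] set_p2 inS[OF old] by blast
    next
      case out
      have "rev_L x = (arev f, b)" using f a out by (simp add: rev_L_eq b_def)
      moreover have "b \<noteq> b2"
      proof
        assume "b = b2"
        then have "a2 = (a + \<sigma> f + - \<sigma> f) mod int n"
          unfolding a2_back[symmetric] volt_arev[OF f(1)] \<open>b = b2\<close>[symmetric] b_def
          by (simp only: mod_add_left_eq mod_add_right_eq)
        then have "a2 = a" using a by simp
        then show False using \<open>a \<noteq> a2\<close> by simp
      qed
      moreover have "(arev f, b) \<notin> set p" using inS[of "(arev f, b)"] f wS by auto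
      moreover have "(arev f, b) \<notin> set W" using newW[of "(arev f, b)"] te' f vw by (metis fst_conv head_arev)
      moreover have "arev f \<noteq> f" using f arev_neq by blast
      ultimately show ?thesis using set_p2 f out v by auto
    next
      case ret
      have "rev_L x = (f, a2)" using f b2 ret a2_back by (simp add: rev_L_eq)
      moreover have "(f, a2) \<notin> set p" using inS[of "(f, a2)"] f wS by auto
      moreover have "(f, a2) \<notin> set W" using newW[of "(f, a2)"] te' f vw by auto
      moreover have "arev f \<noteq> f" using f arev_neq by blast
      ultimately show ?thesis using set_p2 f ret v \<open>a \<noteq> a2\<close> by auto
    next
      case W
      have r: "fst (rev_L x) = arev e'" "arev e' \<noteq> e'"
        using rev_L_loop_run[OF e'] W J unfolding W_def by auto
      have ends: "tail T (arev e') = w" "head T (arev e') = w" using te' by auto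
      have "arev e' \<noteq> f" using ends(1) f(2) vw by blast
      moreover have "arev e' \<noteq> arev f" using ends(2) f(1,2) vw head_arev by force
      moreover have "rev_L x \<notin> set p" using inS[of "rev_L x"] r(1) ends(1) wS by auto
      ultimately have "rev_L x \<notin> set p" "rev_L x \<noteq> (f, a)" "rev_L x \<noteq> (arev f, b2)"
        using r(1) by auto
      moreover have "rev_L x \<notin> set W" using newW r by metis
      ultimately show ?thesis using set_p2 newW[OF W] te' by auto
    qed
  qed
  have len_new: "card ?S * n \<le> length p2 + card ?S * (I + J)"
  proof -
    \<comment> \<open>The detour removes \<open>j\<close> arcs and inserts \<open>n - i\<close> loop
      arcs and two lifts of the edge of \<open>f\<close>.\<close>
    have "length p2 + j + i = length p + n + 2"
      using i_n unfolding p2_def p' W_def by simp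
    moreover have "card ?S = Suc (card S)" using finS wS by simp
    ultimately show ?thesis using len ji iI by (simp add: algebra_simps)
  qed
  have reserve_new: "\<exists>e\<in>loops_at T x. \<exists>a\<in>{0..<int n}. \<exists>r.
        sublist (loop_run e a r) p2 \<and> n \<le> r + I + J * card (nbr_arcs x ?S)" if x: "x \<in> ?S" for x
  proof -
    consider "x = w" | "x = v" | "x \<in> S" "x \<noteq> v" using x by blast
    then show ?thesis
    proof cases
      case 1
      \<comment> \<open>All of \<open>W\<close> serves as the reserve over \<open>w\<close>; its
        length \<open>n - i\<close> is at least \<open>n - I\<close>.\<close>
      have "sublist W p2"
        using sublist_appendI[of W "ps @ [(f, a)]" "(arev f, b2) # rest"] by (simp add: p2_def)
      then show ?thesis
        using 1 e' b iI by (intro bexI[of _ e'] bexI[of _ b] exI[of _ "n - i"]) (auto simp: W_def)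
    next
      case 2
      have "sublist (loop_run e a2 (r - j)) p2"
        using sublist_appendI[of "loop_run e a2 (r - j)" "ps @ (f, a) # W @ [(arev f, b2)]" ss]
        by (simp add: p2_def rest_def)
      then show ?thesis
        using 2 e a2 r_new by (intro bexI[of _ e] bexI[of _ a2] exI[of _ "r - j"]) auto
    next
      case 3
      obtain g c q where g: "g \<in> loops_at T x" "c \<in> {0..<int n}" "sublist (loop_run g c q) p"
        "n \<le> q + I + J * card (nbr_arcs x S)"
        using reserve[OF 3(1)] by blast
      \<comment> \<open>Runs over different vertices use different loops, so the reserve over
        \<open>x\<close> is disjoint from the removed segment and survives whole before or after
        it.\<close>
      have "g \<noteq> e" using g(1) te 3 by (auto simp: loops_at_def)
      then have "set (loop_run g c q) \<inter> set (loop_run e a j) = {}"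
        using set_loop_run by blast
      then have "sublist (loop_run g c q) ps \<or> sublist (loop_run g c q) rest"
        using sublist_append_disjoint[OF g(3)[unfolded p']] run_Cons by (metis list.distinct(1))
      moreover have "sublist ps p2" by (simp add: p2_def)
      moreover have "sublist rest p2"
        using sublist_append_leftI[of rest "ps @ (f, a) # W @ [(arev f, b2)]"]
        by (simp add: p2_def)
      ultimately have "sublist (loop_run g c q) p2"
        using sublist_order.order.trans by blast
      moreover have "n \<le> q + I + J * card (nbr_arcs x ?S)"
        using g(4) mult_le_mono2[OF nbr_mono[of x], of J] by linarith
      ultimately show ?thesis using g by blast
    qed
  qed
  have "partial_cycle I J ?S u p2"
    unfolding partial_cycle_def
    using SV w aw_new dist_new rev_new len_new reserve_new by (auto simp: p2_def)
  then show ?thesis by blast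
qed

lemma partial_cycle_imp_undirected_cycle:
  assumes "partial_cycle I J S u p"
  shows "undirected_cycle L rev_L p" and "card (cycle_verts L p) = length p"
proof -
  have aw: "L.awalk u p u" and p: "p \<noteq> []" and dist: "distinct (map (tail L) p)"
    and rev: "\<forall>x\<in>set p. rev_L x \<notin> set p"
    using assms unfolding partial_cycle_def by auto
  \<comment> \<open>The vertex sequence starts and ends at \<open>u\<close>. Dropping its first
    entry leaves a rotation of the distinct tails.\<close>
  have "L.awalk_verts u p = map (tail L) p @ [u]"
    using aw p L.awalk_verts_conv[of u p] L.awlast_of_awalk[OF aw] by auto
  moreover obtain x q where "p = x # q" "tail L x = u"
    using aw p by (cases p) (auto simp: L.awalk_simps)
  ultimately have "distinct (tl (L.awalk_verts u p))"
    using dist by auto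
  then show "undirected_cycle L rev_L p"
    unfolding undirected_cycle_def L.cycle_def using aw p rev by blast
  show "card (cycle_verts L p) = length p"
    using distinct_card[OF dist] by (simp add: cycle_verts_def)
qed

end

section \<open>Growing a partial cycle to all vertices of the tree\<close>

lemma connected_leaving_arc:
  assumes "bidirected_digraph T arev" and "Digraph_Component.connected (delete_loops T)"
    and "S \<subset> verts T" and "S \<noteq> {}"
  obtains f where "f \<in> arcs T" "tail T f \<in> S" "head T f \<notin> S"
proof (rule ccontr)
  interpret bidirected_digraph T arev by fact
  assume "\<not> thesis"
  with that have closed: "head T f \<in> S" if "f \<in> arcs T" "tail T f \<in> S" for f
    using \<open>f \<in> arcs T\<close> \<open>tail T f \<in> S\<close> by blast
  obtain x y where xy: "x \<in> S" "y \<in> verts T" "y \<notin> S" "x \<in> verts T" using assms(3,4) by blast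
  have "(x, y) \<in> rtrancl_on (verts T) ((arcs_ends (delete_loops T))\<^sup>s)"
    using assms(2) xy by (auto simp: connected_conv delete_loops_def)
  then have "y \<in> S"
  proof (induction rule: rtrancl_on_induct)
    case base
    show ?case by (rule xy(1))
  next
    case (step y z)
    \<comment> \<open>Connectedness refers to the symmetric closure, so a step may run against
      \<open>g\<close>; then \<open>arev g\<close> runs along it.\<close>
    then obtain g where "g \<in> arcs T" "(tail T g = y \<and> head T g = z) \<or> (tail T g = z \<and> head T g = y)"
      by (auto simp: symcl_def delete_loops_def arcs_ends_conv)
    then show ?case using closed[of g] closed[of "arev g"] step by auto
  qed
  with xy show False by blast
qed

lemma (in unit_loop_voltages) card_nbr_arcs_le: "card (nbr_arcs v S) \<le> nonloop_degree T v"
proof -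
  have "nbr_arcs v S \<subseteq> out_arcs (delete_loops T) v"
    by (auto simp: nbr_arcs_def out_arcs_def delete_loops_def)
  moreover have "finite (out_arcs (delete_loops T) v)"
    using fin_digraph.finite_arcs[OF fin] by (simp add: out_arcs_def delete_loops_def)
  ultimately show ?thesis
    by (simp add: nonloop_degree_def out_degree_def card_mono)
qed

text \<open>Connectedness supplies an arc leaving the current set until all vertices are reached.
  The premise \<open>room\<close> is conditional because such an arc forces \<Delta> > 0; for
  \<Delta> = 0 there is a single vertex and no detour.\<close>

lemma (in unit_loop_voltages) spanning_partial_cycle:
  assumes conn: "Digraph_Component.connected (delete_loops T)" and n: "n > 0"
    and deg: "\<forall>v\<in>verts T. nonloop_degree T v \<le> \<Delta>"
    and room: "\<Delta> > 0 \<Longrightarrow> 0 < J \<and> J < n \<and> n div J \<le> I \<and> I + J * \<Delta> \<le> n"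
  shows "\<exists>u p. partial_cycle I J (verts T) u p"
proof -
  have finV: "finite (verts T)" using fin_digraph.finite_verts[OF fin] .
  have grow: "\<exists>S u p. card S = Suc k \<and> partial_cycle I J S u p" if "k < card (verts T)" for k
    using that
  proof (induction k)
    case 0
    then obtain v where "v \<in> verts T" by (metis card.empty ex_in_conv less_irrefl)
    from partial_cycle_base[OF this n] obtain u p where "partial_cycle I J {v} u p" by blast
    then show ?case by (intro exI[of _ "{v}"] exI[of _ u] exI[of _ p]) simp
  next
    case (Suc k)
    then obtain S u p where S: "card S = Suc k" and pc: "partial_cycle I J S u p" by auto
    have SV: "S \<subseteq> verts T" using pc by (simp add: partial_cycle_def)
    have "S \<subset> verts T" using SV S Suc.prems by auto
    moreover have "S \<noteq> {}" using S by auto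
    ultimately obtain f where f: "f \<in> arcs T" "tail T f \<in> S" "head T f \<notin> S"
      using connected_leaving_arc[OF bidirected_digraph conn] by metis
    let ?S = "insert (head T f) S"
    have nbr: "card (nbr_arcs (tail T f) ?S) \<le> \<Delta>"
      using card_nbr_arcs_le deg f(1) by (meson le_trans tail_in_verts)
    have "f \<in> nbr_arcs (tail T f) ?S" using f by (auto simp: nbr_arcs_def)
    then have "\<Delta> > 0" using nbr finite_nbr_arcs by (metis card_gt_0_iff empty_iff less_le_trans)
    note rm = room[OF this]
    have "I + J * card (nbr_arcs (tail T f) ?S) \<le> n"
      using rm mult_le_mono2[OF nbr, of J] by linarith
    then have "\<exists>u p. partial_cycle I J ?S u p"
      using partial_cycle_step[OF pc f(1) refl refl f(2,3)] rm by blast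
    moreover have "card ?S = Suc (Suc k)"
      using S f(3) SV finV finite_subset by (metis card_insert_disjoint)
    ultimately show ?case by blast
  qed
  have "verts T \<noteq> {}" using conn by (auto simp: connected_conv delete_loops_def)
  then have "card (verts T) > 0" using finV by (simp add: card_gt_0_iff)
  then obtain S u p where S: "card S = card (verts T)" and pc: "partial_cycle I J S u p"
    using grow[of "card (verts T) - 1"] by auto
  have "S = verts T" using pc S finV by (simp add: partial_cycle_def card_subset_eq)
  then show ?thesis using pc by blast
qed

section \<open>The numerical choice of \<open>J\<close> and the final count\<close>

lemma detour_budget:
  fixes \<epsilon> :: real and \<Delta> n :: nat
  assumes "0 < \<epsilon>" "\<epsilon> \<le> 1 / 2" "\<Delta> > 0" "real n \<ge> 5 * real \<Delta> / \<epsilon>\<^sup>2"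
  obtains J where "0 < J" "J < n" "real (n div J + J * \<Delta>) \<le> \<epsilon> * n"
proof -
  \<comment> \<open>With \<open>n = \<Delta> * s\<^sup>2\<close> and \<open>J\<close> near
    \<open>s\<close>, both \<open>n div J\<close> and \<open>J * \<Delta>\<close> are about
    \<open>\<Delta> * s\<close>. What remains is
    \<open>2 * s + 1 \<le> \<epsilon> * s\<^sup>2\<close>.\<close>
  define s where "s = sqrt (n / \<Delta>)"
  have n: "real n > 0"
    using assms by (smt (verit) divide_pos_pos of_nat_0_less_iff zero_less_power)
  have s: "s > 0" "real n = \<Delta> * s\<^sup>2" using n assms(3) by (simp_all add: s_def)
  have "5 \<le> (\<epsilon> * s)\<^sup>2"
    using assms s(2) by (simp add: field_simps power_mult_distrib)
  \<comment> \<open>The fraction 223/100 is a rational lower bound for the square root of 5. With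
    \<epsilon> at most 1/2 it gives \<open>s \<ge> 446 / 100\<close>, and the surplus
    \<open>23 / 100 * s\<close> just exceeds 1.\<close>
  then have "(223 / 100)\<^sup>2 \<le> (\<epsilon> * s)\<^sup>2" by (simp add: power2_eq_square)
  then have es: "223 / 100 \<le> \<epsilon> * s"
    by (rule power2_le_imp_le) (use assms s in auto)
  moreover have "\<epsilon> * s \<le> 1 / 2 * s" using assms s by (intro mult_right_mono) auto
  ultimately have s4: "s \<ge> 446 / 100" by linarith
  have "223 / 100 * s \<le> \<epsilon> * s * s" using es s by (intro mult_right_mono) auto
  then have "2 * s + 1 \<le> \<epsilon> * s * s" using s4 by linarith
  then have key: "2 * s + 1 \<le> \<epsilon> * s\<^sup>2" by (simp add: power2_eq_square mult.assoc)
  define J where "J = nat \<lceil>s\<rceil>"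
  have J: "s \<le> real J" "real J \<le> s + 1" using s unfolding J_def by linarith+
  have "real (n div J) \<le> real n / real J" by (rule of_nat_div_le_of_nat)
  also have "\<dots> \<le> real n / s" using J s by (intro divide_left_mono) auto
  also have "\<dots> = \<Delta> * s" using s by (simp add: power2_eq_square)
  finally have "real (n div J + J * \<Delta>) \<le> \<Delta> * s + (s + 1) * \<Delta>"
    using mult_right_mono[OF J(2), of "real \<Delta>"] by simp
  also have "\<dots> = \<Delta> * (2 * s + 1)" by (simp add: algebra_simps)
  also have "\<dots> \<le> \<Delta> * (\<epsilon> * s\<^sup>2)" using key by (intro mult_left_mono) auto
  also have "\<dots> = \<epsilon> * n" using s by simp
  finally have main: "real (n div J + J * \<Delta>) \<le> \<epsilon> * n" .
  have "J \<le> J * \<Delta>" using assms(3) by simp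
  then have "real J \<le> real (n div J + J * \<Delta>)" by linarith
  also have "\<dots> \<le> 1 / 2 * real n" using main mult_right_mono[OF assms(2), of "real n"] by simp
  also have "\<dots> < real n" using n by simp
  finally show ?thesis using that[of J] main J s by auto
qed

theorem theorem6:
  fixes T :: "('v, 'e) pre_digraph" and arev :: "'e \<Rightarrow> 'e" and \<sigma> :: "'e \<Rightarrow> int"
    and \<Delta> n :: nat and \<epsilon> :: real
  assumes "0 < \<epsilon>" and "\<epsilon> \<le> 1 / 2"
    and "real n \<ge> 5 * real \<Delta> / \<epsilon>\<^sup>2"
    and "reflexive_tree T arev"
    and "\<forall>v\<in>verts T. nonloop_degree T v \<le> \<Delta>"
    and "voltage_assignment n T arev \<sigma>"
    and "\<forall>v\<in>verts T. \<forall>e\<in>loops_at T v. coprime (\<sigma> e) (int n)"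
  shows "\<exists>p. undirected_cycle (lift n T \<sigma>) (lift_rev n T arev \<sigma>) p \<and>
    real (card (cycle_verts (lift n T \<sigma>) p)) \<ge> (1 - \<epsilon>) * real (card (verts (lift n T \<sigma>)))"
proof -
  have fin: "fin_digraph T" and bi: "bidirected_digraph T arev"
    and conn: "Digraph_Component.connected (delete_loops T)"
    and loops: "\<And>v. v \<in> verts T \<Longrightarrow> card (loops_at T v) = 2"
    using assms(4) by (auto simp: reflexive_tree_def undirected_tree_def)
  interpret unit_loop_voltages T arev \<sigma> n
  proof (intro unit_loop_voltages.intro unit_loop_voltages_axioms.intro bi fin assms(6))
    show "loops_at T v \<noteq> {}" if "v \<in> verts T" for v
      using loops[OF that] by auto
    show "coprime (\<sigma> e) (int n)" if "v \<in> verts T" "e \<in> loops_at T v" for v e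
      using assms(7) that by blast
  qed
  have "verts T \<noteq> {}" using conn by (auto simp: connected_conv delete_loops_def)
  \<comment> \<open>For \<Delta> = 0 the lower bound on \<open>n\<close> does not make it positive.
    Positivity follows from a loop having a voltage in \<open>{0..<int n}\<close>.\<close>
  then obtain v e where "v \<in> verts T" "e \<in> loops_at T v" using loop_ex by blast
  then have n: "n > 0" using assms(6) by (force simp: voltage_assignment_def loops_at_def)
  obtain I J where IJ: "real (I + J) \<le> \<epsilon> * n"
    and room: "\<Delta> > 0 \<Longrightarrow> 0 < J \<and> J < n \<and> n div J \<le> I \<and> I + J * \<Delta> \<le> n"
  proof (cases "\<Delta> > 0")
    case True
    obtain J where J: "0 < J" "J < n" "real (n div J + J * \<Delta>) \<le> \<epsilon> * n"
      using detour_budget[OF assms(1,2) True assms(3)] .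
    have "\<epsilon> * n \<le> 1 * real n" using assms(2) by (intro mult_right_mono) auto
    then have "real (n div J + J * \<Delta>) \<le> real n" using J(3) by linarith
    then have "n div J + J * \<Delta> \<le> n" by linarith
    moreover have "J \<le> J * \<Delta>" using True by simp
    then have "real (n div J + J) \<le> \<epsilon> * n" using J(3) by linarith
    ultimately show ?thesis using that[of "n div J" J] J by simp
  next
    case False
    \<comment> \<open>Without detours nothing is lost, so both parameters can be 0.\<close>
    then show ?thesis using that[of 0 0] assms(1) by simp
  qed
  obtain u p where pc: "partial_cycle I J (verts T) u p"
    using spanning_partial_cycle[OF conn n assms(5) room] by blast
  let ?m = "card (verts T)"
  have "?m * n \<le> length p + ?m * (I + J)" using pc by (simp add: partial_cycle_def)
  then have "real (?m * n) \<le> real (length p + ?m * (I + J))" by (rule of_nat_mono)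
  moreover have "real ?m * real (I + J) \<le> real ?m * (\<epsilon> * n)"
    using IJ by (intro mult_left_mono) auto
  ultimately have "(1 - \<epsilon>) * real (?m * n) \<le> real (length p)"
    by (simp add: algebra_simps)
  then show ?thesis
    using partial_cycle_imp_undirected_cycle[OF pc] by (auto simp: card_cartesian_product)
qed

end
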